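(* There is a constant $K>0$ such that the following holds for every integer $N\ge 3$ and every $N$-tuple of integers $(a^1,\ldots,a^N)$, not all zero. Set $n:=\max\{|a^1|,\ldots,|a^N|\}$. Then there is a sequence of no more than $K(N-1)(1+\log n)$ steps, each step being the addition of one entry of the current $N$-tuple to another entry or the subtraction of one entry from another entry, after which all but one entry in the $N$-tuple are zero. (The constant $K$ is independent of $n$ and $N$.)
   Context: Superscripts on $a^j$ are indices, not powers. A step applied to an integer $N$-tuple replaces its $p$-th entry $x_p$ by $x_p+x_q$ or by $x_p-x_q$, for some $p\neq q$, leaving all other entries unchanged. *)

theory Defs
  imports Complex_Main
begin

(* An N-tuple of integers is an int list of length N. *)

definition entry_step :: "int list \<Rightarrow> int list \<Rightarrow> bool" where
  "entry_step x y \<longleftrightarrow>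
     (\<exists>p < length x. \<exists>q < length x. p \<noteq> q \<and>
        (y = x[p := x ! p + x ! q] \<or> y = x[p := x ! p - x ! q]))"

(* Exactly one entry is nonzero: steps are invertible, so a nonzero tuple
   never becomes zero. *)
definition all_but_one_zero :: "int list \<Rightarrow> bool" where
  "all_but_one_zero x \<longleftrightarrow>
     (\<exists>i < length x. \<forall>j < length x. x ! j = 0 \<longleftrightarrow> j \<noteq> i)"

end

theory Submission
  imports Defs
begin

text \<open>
  Take three entries with absolute values \<open>a \<ge> b \<ge> c\<close> and \<open>b > 0\<close>. Repeated addition turns
  the pair \<open>(b, c)\<close> into consecutive terms of a Fibonacci-like sequence, which grows
  exponentially; running the sequence up past \<open>a\<close> and back down again, and subtracting greedily
  from the first entry on the way down, replaces \<open>a\<close> by some \<open>a' < b\<close> with \<open>2 * a' < a\<close> in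
  \<open>O(1 + ln (a / b))\<close> steps. No entry has to be zero for this. The potential
  \<open>\<Sum> (1 + ln \<bar>x\<bar>)\<close> over the nonzero entries drops by at least \<open>max (ln 2) (ln (a / b))\<close>, so that
  the total cost is bounded by a multiple of the initial potential.
\<close>

section \<open>Sign independence of steps\<close>

lemma entry_step_add:
  "\<lbrakk>p < length x; q < length x; p \<noteq> q\<rbrakk> \<Longrightarrow> entry_step x (x[p := x ! p + x ! q])"
  unfolding entry_step_def by blast

lemma entry_step_diff:
  "\<lbrakk>p < length x; q < length x; p \<noteq> q\<rbrakk> \<Longrightarrow> entry_step x (x[p := x ! p - x ! q])"
  unfolding entry_step_def by blast

text \<open>Flipping signs at most exchanges, up to sign, the sum and the difference of two entries,
  and both are allowed. So only absolute values matter, and the reduction may assume nonnegative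
  entries.\<close>

lemma entry_step_abs_sim:
  assumes "entry_step x y" and abs_eq: "map abs x' = map abs x"
  shows "\<exists>y'. entry_step x' y' \<and> map abs y' = map abs y"
proof -
  from assms(1) obtain p q where pq: "p < length x" "q < length x" "p \<noteq> q"
    and y: "y = x[p := x ! p + x ! q] \<or> y = x[p := x ! p - x ! q]"
    unfolding entry_step_def by blast
  have len: "length x' = length x"
    using abs_eq by (metis length_map)
  have nth_abs: "\<bar>x' ! i\<bar> = \<bar>x ! i\<bar>" if "i < length x" for i
    using abs_eq that len by (metis nth_map)
  have "\<exists>v \<in> {x' ! p + x' ! q, x' ! p - x' ! q}. \<bar>v\<bar> = \<bar>y ! p\<bar>"
    using y pq nth_abs[OF pq(1)] nth_abs[OF pq(2)] by auto
  then obtain v where v: "v \<in> {x' ! p + x' ! q, x' ! p - x' ! q}" "\<bar>v\<bar> = \<bar>y ! p\<bar>" ..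
  have "y = x[p := y ! p]"
    using y pq by auto
  then have "map abs (x'[p := v]) = map abs y"
    using v(2) abs_eq by (metis map_update)
  moreover have "entry_step x' (x'[p := v])"
    using v(1) pq len entry_step_add[of p x' q] entry_step_diff[of p x' q] by auto
  ultimately show ?thesis
    by blast
qed

lemma entry_steps_abs_sim:
  assumes "(entry_step ^^ m) x y" "map abs x' = map abs x"
  shows "\<exists>y'. (entry_step ^^ m) x' y' \<and> map abs y' = map abs y"
  using assms
proof (induction m arbitrary: y)
  case 0
  then show ?case by auto
next
  case (Suc m)
  then obtain z where "(entry_step ^^ m) x z" "entry_step z y"
    by auto
  moreover from this(1) obtain z' where "(entry_step ^^ m) x' z'" "map abs z' = map abs z"
    using Suc.IH Suc.prems(2) by blast
  ultimately show ?case
    using entry_step_abs_sim by (metis relpowp_Suc_I)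
qed

lemma all_but_one_zero_abs_cong:
  assumes "map abs x = map abs y" "all_but_one_zero x"
  shows "all_but_one_zero y"
proof -
  have len: "length x = length y"
    using assms(1) by (metis length_map)
  moreover have "x ! i = 0 \<longleftrightarrow> y ! i = 0" if "i < length y" for i
    using assms(1) that len by (metis abs_eq_0_iff nth_map)
  ultimately show ?thesis
    using assms(2) unfolding all_but_one_zero_def by auto
qed

section \<open>Reducing one entry by a Fibonacci-like pair\<close>

text \<open>Each level of the recursion costs three steps: one up, one down, at most one subtraction
  from entry \<open>p\<close>. For \<open>k = 0\<close> the last hypothesis gives
  \<open>2 * x ! p < x ! q + x ! r\<close>, hence \<open>x ! p < x ! q\<close> already. The case
  \<open>a = x ! p\<close> covers the levels whose pair has outgrown \<open>x ! p\<close>.\<close>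

lemma fibonacci_reduction:
  assumes "p < length x" "q < length x" "r < length x" "p \<noteq> q" "p \<noteq> r" "q \<noteq> r"
    and "0 \<le> x ! p" "0 < x ! q" "0 \<le> x ! r" "x ! r \<le> x ! q"
    and "2 * x ! p * 2 ^ k < 3 ^ k * (x ! q + x ! r)"
  shows "\<exists>m a. m \<le> 3 * k \<and> (entry_step ^^ m) x (x[p := a]) \<and> 0 \<le> a \<and> a < x ! q
    \<and> (a = x ! p \<or> a \<le> x ! p - x ! q)"
  using assms
proof (induction k arbitrary: x q r)
  case 0
  then show ?case
    by (intro exI[of _ 0] exI[of _ "x ! p"]) auto
next
  case (Suc k)
  let ?u = "x ! q" and ?v = "x ! r"
  define y where "y = x[r := ?v + ?u]"
  have up: "entry_step x y"
    unfolding y_def using Suc.prems by (intro entry_step_add) auto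
  have y_nth: "y ! p = x ! p" "y ! q = ?u" "y ! r = ?v + ?u" and len: "length y = length x"
    using Suc.prems unfolding y_def by auto
  \<comment> \<open>As \<open>v \<le> u\<close>, the sum \<open>u + v\<close> grows by a factor of at least 3/2.\<close>
  have "3 * (?u + ?v) \<le> 2 * (y ! r + y ! q)"
    using Suc.prems y_nth by simp
  then have "3 ^ k * (3 * (?u + ?v)) \<le> 3 ^ k * (2 * (y ! r + y ! q))"
    by (intro mult_left_mono) auto
  then have "2 * y ! p * 2 ^ k < 3 ^ k * (y ! r + y ! q)"
    using Suc.prems(11) unfolding y_nth(1) power_Suc by linarith
  \<comment> \<open>The roles of \<open>q\<close> and \<open>r\<close> swap, since entry
    \<open>r\<close> is now the larger one.\<close>
  then obtain m a where m: "m \<le> 3 * k" "(entry_step ^^ m) y (y[p := a])"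
    and a: "0 \<le> a" "a < ?v + ?u" "a = x ! p \<or> a \<le> x ! p - (?v + ?u)"
    using Suc.IH[of y r q] Suc.prems len y_nth by auto
  define w z where "w = y[p := a]" and "z = x[p := a]"
  \<comment> \<open>The recursion left entries \<open>q\<close> and \<open>r\<close> as they were in
    \<open>y\<close>, so this subtraction undoes the first step.\<close>
  have "w[r := w ! r - w ! q] = z"
    using Suc.prems y_nth len unfolding w_def z_def y_def
    by (auto simp: list_update_swap[of p r])
  then have "entry_step w z"
    using entry_step_diff[of r w q] Suc.prems len unfolding w_def by simp
  then have xz: "(entry_step ^^ (Suc (Suc m))) x z"
    using up m(2) unfolding w_def by (meson relpowp_Suc_I relpowp_Suc_I2)
  show ?case
  proof (cases "a < ?u")
    case True
    then show ?thesis
      using xz m(1) a Suc.prems unfolding z_def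
      by (intro exI[of _ "Suc (Suc m)"] exI[of _ a]) auto
  next
    \<comment> \<open>One subtraction is enough: \<open>a < ?u + ?v\<close> gives
      \<open>a - ?u < ?v\<close>, and \<open>?v\<close> is at most \<open>?u\<close>.\<close>
    case False
    have "entry_step z (x[p := a - ?u])"
      using entry_step_diff[of p z q] Suc.prems unfolding z_def by simp
    then have "(entry_step ^^ (Suc (Suc (Suc m)))) x (x[p := a - ?u])"
      using xz by (metis relpowp_Suc_I)
    then show ?thesis
      using m(1) a False Suc.prems
      by (intro exI[of _ "Suc (Suc (Suc m))"] exI[of _ "a - ?u"]) auto
  qed
qed

section \<open>The logarithmic potential\<close>

text \<open>The summand 1 pays for turning an entry into zero; with the logarithm alone, removing an
  entry of absolute value 1 would gain nothing.\<close>

definition entry_weight :: "int \<Rightarrow> real" where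
  "entry_weight x = (if x = 0 then 0 else 1 + ln \<bar>real_of_int x\<bar>)"

lemma entry_weight_nonneg: "0 \<le> entry_weight x"
  unfolding entry_weight_def by (auto intro!: add_nonneg_nonneg)

lemma entry_weight_mono:
  assumes "\<bar>x\<bar> \<le> n" "0 < n"
  shows "entry_weight x \<le> 1 + ln (real_of_int n)"
proof (cases "x = 0")
  case True
  then show ?thesis
    using assms(2) by (auto simp: entry_weight_def intro!: add_nonneg_nonneg)
next
  case False
  then have "ln \<bar>real_of_int x\<bar> \<le> ln (real_of_int n)"
    using assms by (intro ln_mono) auto
  then show ?thesis
    using False by (simp add: entry_weight_def)
qed

text \<open>For positive \<open>a'\<close>, halving yields the bound \<open>ln 2\<close> and
  \<open>a' < b\<close> yields the other one. For \<open>a' = 0\<close> the drop is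
  \<open>1 + ln a\<close>, which suffices as \<open>ln 2 < 1\<close> and \<open>ln b\<close> is
  nonnegative.\<close>

lemma entry_weight_drop:
  assumes "0 \<le> a'" "a' < b" "b \<le> a" "2 * a' \<le> a"
  shows "max (ln 2) (ln (real_of_int a / real_of_int b)) \<le> entry_weight a - entry_weight a'"
proof -
  have pos: "0 < a" "0 < b"
    using assms by auto
  have weight_a: "entry_weight a = 1 + ln (real_of_int a)"
    and quot: "ln (real_of_int a / real_of_int b) = ln (real_of_int a) - ln (real_of_int b)"
    using pos by (simp_all add: entry_weight_def ln_div)
  have ln_nonneg: "0 \<le> ln (real_of_int a)" "0 \<le> ln (real_of_int b)"
    using pos by simp_all
  show ?thesis
  proof (cases "a' = 0")
    case True
    then have "entry_weight a' = 0"
      by (simp add: entry_weight_def)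
    then show ?thesis
      using ln_nonneg ln_2_less_1 unfolding weight_a quot by (intro max.boundedI) linarith+
  next
    case False
    then have pos': "0 < a'"
      using assms(1) by simp
    then have weight_a': "entry_weight a' = 1 + ln (real_of_int a')"
      by (simp add: entry_weight_def)
    have "ln 2 + ln (real_of_int a') = ln (real_of_int (2 * a'))"
      using pos' by (simp add: ln_mult)
    also have "\<dots> \<le> ln (real_of_int a)"
      using pos' assms by (intro ln_mono) auto
    finally have "ln 2 + ln (real_of_int a') \<le> ln (real_of_int a)" .
    moreover have "ln (real_of_int a') \<le> ln (real_of_int b)"
      using pos' assms by (intro ln_mono) auto
    ultimately show ?thesis
      unfolding weight_a weight_a' quot by (intro max.boundedI) linarith+
  qed
qed

lemma power_three_halves_gt:
  fixes t d :: real
  assumes "0 < t" "ln 2 \<le> d" "ln t \<le> d"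
  shows "\<exists>k::nat. 2 * t < (3 / 2) ^ k \<and> real k \<le> 8 * d"
proof -
  \<comment> \<open>This bound and the next follow from \<open>ln y \<le> y - 1\<close> at the
    reciprocals 1/2 and 2/3.\<close>
  have ln2: "1 / 2 \<le> ln (2::real)"
    using ln_one_minus_pos_lower_bound[of "1/2"] ln_le_minus_one[of "1/2::real"]
    by (simp add: ln_div)
  have ln32: "1 / 3 \<le> ln (3 / 2 :: real)"
    using ln_le_minus_one[of "2/3::real"] by (simp add: ln_div)
  \<comment> \<open>The factor 3 inverts the bound 1/3 for \<open>ln (3 / 2)\<close>. Then
    \<open>k\<close> is at most \<open>3 * ln 2 + 3 * d + 1\<close>, and \<open>ln 2 \<le> d\<close>
    with \<open>1 \<le> 2 * d\<close> gives \<open>8 * d\<close>.\<close>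
  define s where "s = 3 * (ln 2 + d)"
  define k where "k = nat (\<lfloor>s\<rfloor> + 1)"
  have "0 \<le> s"
    using ln2 assms unfolding s_def by simp
  then have "real k = of_int \<lfloor>s\<rfloor> + 1"
    unfolding k_def by simp
  then have k: "s < real k" "real k \<le> s + 1"
    by linarith+
  have "ln (2 * t) = ln 2 + ln t"
    using assms(1) by (simp add: ln_mult)
  also have "\<dots> \<le> s * (1 / 3)"
    using assms unfolding s_def by simp
  also have "\<dots> < real k * (1 / 3)"
    using k by simp
  also have "\<dots> \<le> real k * ln (3 / 2)"
    using ln32 by (intro mult_left_mono) auto
  also have "\<dots> = ln ((3 / 2) ^ k)"
    by (simp add: ln_realpow)
  finally have "2 * t < (3 / 2) ^ k"
    using assms(1) by (subst (asm) ln_less_cancel_iff) auto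
  moreover have "real k \<le> 8 * d"
    using k(2) ln2 assms(2) unfolding s_def by argo
  ultimately show ?thesis
    by blast
qed

section \<open>Rounds and their total cost\<close>

lemma reduction_round:
  assumes "p < length x" "q < length x" "r < length x" "p \<noteq> q" "p \<noteq> r" "q \<noteq> r"
    and "0 < x ! q" "0 \<le> x ! r" "x ! r \<le> x ! q" "x ! q \<le> x ! p"
  shows "\<exists>m a. (entry_step ^^ m) x (x[p := a]) \<and> 0 \<le> a \<and> a < x ! p
    \<and> real m \<le> 24 * (entry_weight (x ! p) - entry_weight a)"
proof -
  let ?t = "real_of_int (x ! p) / real_of_int (x ! q)"
  define d where "d = max (ln 2) (ln ?t)"
  obtain k where k: "2 * ?t < (3 / 2) ^ k" "real k \<le> 8 * d"
    using power_three_halves_gt[of ?t d] assms unfolding d_def by auto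
  have "real_of_int (2 * x ! p * 2 ^ k) < real_of_int (3 ^ k * x ! q)"
    using k(1) assms by (simp add: power_divide field_simps)
  then have "2 * x ! p * 2 ^ k < 3 ^ k * x ! q"
    by linarith
  also have "\<dots> \<le> 3 ^ k * (x ! q + x ! r)"
    using assms by (intro mult_left_mono) auto
  finally have "2 * x ! p * 2 ^ k < 3 ^ k * (x ! q + x ! r)" .
  then obtain m a where m: "m \<le> 3 * k" "(entry_step ^^ m) x (x[p := a])"
    and a: "0 \<le> a" "a < x ! q" "a = x ! p \<or> a \<le> x ! p - x ! q"
    using fibonacci_reduction[OF assms(1-6), of k] assms by auto
  \<comment> \<open>As \<open>a < x ! q \<le> x ! p\<close>, the case \<open>a = x ! p\<close> is
    excluded. Adding \<open>a < x ! q\<close> to \<open>a \<le> x ! p - x ! q\<close> gives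
    \<open>2 * a < x ! p\<close>. The constant 24 is 3 steps per level times \<open>8 * d\<close>
    levels.\<close>
  have "d \<le> entry_weight (x ! p) - entry_weight a"
    using entry_weight_drop[of a "x ! q" "x ! p"] a assms unfolding d_def by auto
  then have "real m \<le> 24 * (entry_weight (x ! p) - entry_weight a)"
    using of_nat_mono[OF m(1), where 'a = real] k(2) by simp
  then show ?thesis
    using m a assms by (intro exI[of _ m] exI[of _ a]) auto
qed

text \<open>Length at least 3 supplies a third index, whose entry may be zero. Two of the three
  entries are positive, so the middle one is positive in every ordering.\<close>

lemma obtain_sorted_triple:
  fixes x :: "int list"
  assumes "3 \<le> length x" "\<forall>v \<in> set x. 0 \<le> v"
    and "i < length x" "j < length x" "i \<noteq> j" "x ! i \<noteq> 0" "x ! j \<noteq> 0"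
  obtains p q r where "p < length x" "q < length x" "r < length x" "p \<noteq> q" "p \<noteq> r" "q \<noteq> r"
    "0 < x ! q" "0 \<le> x ! r" "x ! r \<le> x ! q" "x ! q \<le> x ! p"
proof -
  have "card {i, j} < card {..<length x}"
    using assms by simp
  then have "\<not> {..<length x} \<subseteq> {i, j}"
    by (metis card_mono finite.emptyI finite.insertI leD)
  then obtain k where k: "k < length x" "k \<noteq> i" "k \<noteq> j"
    by auto
  have pos: "0 < x ! i" "0 < x ! j" "0 \<le> x ! k"
    using assms k by (auto simp: less_le)
  consider "x ! k \<le> x ! j" "x ! j \<le> x ! i" |
    "x ! j \<le> x ! k" "x ! k \<le> x ! i" |
    "x ! k \<le> x ! i" "x ! i \<le> x ! j" |
    "x ! i \<le> x ! k" "x ! k \<le> x ! j" |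
    "x ! j \<le> x ! i" "x ! i \<le> x ! k" |
    "x ! i \<le> x ! j" "x ! j \<le> x ! k"
    by linarith
  then show thesis
  proof cases
    case 1
    then show thesis
      using pos assms(3-5) k by (intro that[of i j k]) auto
  next
    case 2
    then show thesis
      using pos assms(3-5) k by (intro that[of i k j]) auto
  next
    case 3
    then show thesis
      using pos assms(3-5) k by (intro that[of j i k]) auto
  next
    case 4
    then show thesis
      using pos assms(3-5) k by (intro that[of j k i]) auto
  next
    case 5
    then show thesis
      using pos assms(3-5) k by (intro that[of k i j]) auto
  next
    case 6
    then show thesis
      using pos assms(3-5) k by (intro that[of k j i]) auto
  qed
qed

lemma sum_list_update_diff:
  fixes xs :: "'a :: ab_group_add list"
  shows "k < length xs \<Longrightarrow> sum_list (xs[k := v]) = sum_list xs + v - xs ! k"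
  by (induction xs arbitrary: k) (auto simp: algebra_simps split: nat.split)

text \<open>Termination comes from the sum of the entries, a natural number that falls in each
  round. The real-valued potential only counts steps: the costs of the rounds telescope.\<close>

lemma reduce_nonneg:
  assumes "3 \<le> length x" "\<forall>v \<in> set x. 0 \<le> v" "\<exists>i < length x. x ! i \<noteq> 0"
  shows "\<exists>m y. real m \<le> 24 * sum_list (map entry_weight x)
    \<and> (entry_step ^^ m) x y \<and> all_but_one_zero y"
  using assms
proof (induction "nat (sum_list x)" arbitrary: x rule: less_induct)
  case less
  show ?case
  proof (cases "all_but_one_zero x")
    case True
    then show ?thesis
      by (intro exI[of _ 0] exI[of _ x]) (auto intro!: sum_list_nonneg entry_weight_nonneg)
  next
    case False
    then obtain i j where ij: "i < length x" "j < length x" "i \<noteq> j" "x ! i \<noteq> 0" "x ! j \<noteq> 0"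
      using less.prems(3) unfolding all_but_one_zero_def by metis
    obtain p q r where pqr: "p < length x" "q < length x" "r < length x"
      "p \<noteq> q" "p \<noteq> r" "q \<noteq> r" "0 < x ! q" "0 \<le> x ! r" "x ! r \<le> x ! q" "x ! q \<le> x ! p"
      by (rule obtain_sorted_triple[OF less.prems(1,2) ij])
    obtain m a where a: "(entry_step ^^ m) x (x[p := a])" "0 \<le> a" "a < x ! p"
      and m: "real m \<le> 24 * (entry_weight (x ! p) - entry_weight a)"
      using reduction_round[OF pqr] by blast
    let ?z = "x[p := a]"
    have z_nonneg: "\<forall>v \<in> set ?z. 0 \<le> v"
      using less.prems(2) a(2) set_update_subset_insert[of x p a] by blast
    have "sum_list ?z = sum_list x + a - x ! p"
      using pqr(1) by (rule sum_list_update_diff)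
    moreover have "0 \<le> sum_list ?z"
      using z_nonneg by (simp add: sum_list_nonneg)
    ultimately have "nat (sum_list ?z) < nat (sum_list x)"
      using a(3) by linarith
    \<comment> \<open>Entry \<open>q\<close> is positive and unchanged by the round.\<close>
    moreover have "\<exists>i < length ?z. ?z ! i \<noteq> 0"
      using pqr by (intro exI[of _ q]) auto
    ultimately obtain m' y where
      m': "real m' \<le> 24 * sum_list (map entry_weight ?z)" "(entry_step ^^ m') ?z y"
      "all_but_one_zero y"
      using less.hyps[of ?z] less.prems(1) z_nonneg by auto
    have "sum_list (map entry_weight ?z)
        = sum_list (map entry_weight x) + entry_weight a - entry_weight (x ! p)"
      using pqr(1) by (simp add: map_update sum_list_update_diff)
    then have "real (m + m') \<le> 24 * sum_list (map entry_weight x)"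
      using m m'(1) by simp
    moreover have "(entry_step ^^ (m + m')) x y"
      using a(1) m'(2) by (auto simp: relpowp_add)
    ultimately show ?thesis
      using m'(3) by blast
  qed
qed

theorem theorem3p1:
  shows "\<exists>K::real. K > 0 \<and>
    (\<forall>(N::nat) (a::int list). N \<ge> 3 \<longrightarrow> length a = N \<longrightarrow> (\<exists>i<N. a ! i \<noteq> 0) \<longrightarrow>
      (let n = Max {\<bar>a ! i\<bar> | i. i < N} in
        \<exists>(m::nat) (b::int list).
          real m \<le> K * (real N - 1) * (1 + ln (real_of_int n)) \<and>
          (entry_step ^^ m) a b \<and> all_but_one_zero b))"
proof -
  have main: "\<exists>m b. real m \<le> 36 * (real N - 1) * (1 + ln (real_of_int n)) \<and>
      (entry_step ^^ m) a b \<and> all_but_one_zero b"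
    if N: "N \<ge> 3" "length a = N" and nz: "\<exists>i<N. a ! i \<noteq> 0"
      and n: "n = Max {\<bar>a ! i\<bar> | i. i < N}" for N n and a :: "int list"
  proof -
    let ?x = "map abs a"
    have "\<exists>i < length ?x. ?x ! i \<noteq> 0"
      using nz N(2) by auto
    then obtain m y where m: "real m \<le> 24 * sum_list (map entry_weight ?x)"
      and y: "(entry_step ^^ m) ?x y" "all_but_one_zero y"
      using reduce_nonneg[of ?x] N by auto
    obtain b where b: "(entry_step ^^ m) a b" "map abs b = map abs y"
      \<comment> \<open>The steps found for the absolute values are replayed on the signed
        tuple.\<close>
      using entry_steps_abs_sim[OF y(1), of a] by (auto simp: comp_def)
    have le_n: "\<bar>a ! i\<bar> \<le> n" if "i < N" for i
      unfolding n using that by (intro Max_ge) auto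
    have n_pos: "0 < n"
      using nz le_n by fastforce
    have "entry_weight v \<le> 1 + ln (real_of_int n)" if "v \<in> set ?x" for v
      using that le_n n_pos N(2) by (auto simp: in_set_conv_nth intro!: entry_weight_mono)
    then have "sum_list (map entry_weight ?x) \<le> sum_list (map (\<lambda>_. 1 + ln (real_of_int n)) ?x)"
      by (intro sum_list_mono) auto
    also have "\<dots> = real N * (1 + ln (real_of_int n))"
      using N(2) by (simp add: sum_list_triv comp_def)
    \<comment> \<open>For \<open>N \<ge> 3\<close>, \<open>N\<close> is at most
      \<open>3 / 2 * (N - 1)\<close>; hence \<open>36 = 24 * 3 / 2\<close>.\<close>
    also have "\<dots> \<le> (3 / 2 * (real N - 1)) * (1 + ln (real_of_int n))"
      using N(1) n_pos by (intro mult_right_mono) (auto intro!: add_nonneg_nonneg)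
    finally have "real m \<le> 24 * ((3 / 2 * (real N - 1)) * (1 + ln (real_of_int n)))"
      using m by linarith
    then have "real m \<le> 36 * (real N - 1) * (1 + ln (real_of_int n))"
      by (simp add: algebra_simps)
    then show ?thesis
      using b y(2) all_but_one_zero_abs_cong[of y b] by auto
  qed
  show ?thesis
    unfolding Let_def by (rule exI[of _ 36]) (use main in auto)
qed

end
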